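(* Let $ABC$ be a triangle. Draw lines $l_A, l_B, l_C$ through the vertices $A, B, C$ respectively, and let $l'_A, l'_B, l'_C$ be the lines symmetric to $l_A, l_B, l_C$ with respect to the bisectors of the angles $A, B, C$ of the triangle, respectively. Then the lines $l_A, l'_A, l_B, l'_B, l_C, l'_C$ are tangent to a conic.
   Context: The setting is the Euclidean plane. The conclusion is that there is one conic to which all six lines are tangent.
   Formalization: If three distinct lines of the six concur or are parallel, no nondegenerate conic touches all six; there the conic is replaced by a degenerate one, a pair of points (possibly at infinity) with each line through one of them. Asymptotes count as tangents. *)

theory Defs
  imports "HOL-Analysis.Analysis"
begin

definition is_line :: "(real^2) set \<Rightarrow> bool" where
  "is_line l \<longleftrightarrow> affine l \<and> aff_dim l = 1"

definition vec_angle :: "real^2 \<Rightarrow> real^2 \<Rightarrow> real" where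
  "vec_angle v w = arccos (v \<bullet> w / (norm v * norm w))"

(* The whole line carrying the interior bisector of the angle B A C: a point on the ray
   inside the angle makes half of that angle with both sides, and a point on the opposite
   ray makes the supplement of that half with both sides.  Reflection in the exterior
   bisector sends each line through A to the same line as reflection in this one. *)
definition angle_bisector :: "real^2 \<Rightarrow> real^2 \<Rightarrow> real^2 \<Rightarrow> (real^2) set" where
  "angle_bisector B A C =
     insert A {X. vec_angle (B - A) (X - A) = vec_angle (C - A) (X - A)}"

(* For a line m, closest_point m x is the foot of the perpendicular from x. *)
definition reflection_in :: "(real^2) set \<Rightarrow> real^2 \<Rightarrow> real^2" where
  "reflection_in m x = 2 *\<^sub>R closest_point m x - x"

(* The Euclidean plane inside the real projective plane; points of the latter are the
   nonzero vectors of real^3 up to scaling, those with third coordinate 0 being at infinity. *)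
definition homog :: "real^2 \<Rightarrow> real^3" where
  "homog x = vector [x $ 1, x $ 2, 1]"

(* The line l together with its point at infinity, as a plane through the origin. *)
definition proj_closure :: "(real^2) set \<Rightarrow> (real^3) set" where
  "proj_closure l = span (homog ` l)"

(* Concurrent in the projective sense: parallel lines meet at infinity. *)
definition concurrent3 :: "(real^2) set \<Rightarrow> (real^2) set \<Rightarrow> (real^2) set \<Rightarrow> bool" where
  "concurrent3 k l m \<longleftrightarrow>
     (\<exists>p. p \<noteq> 0 \<and> p \<in> proj_closure k \<and> p \<in> proj_closure l \<and> p \<in> proj_closure m)"

definition no_three_concurrent :: "(real^2) set set \<Rightarrow> bool" where
  "no_three_concurrent S \<longleftrightarrow>
     (\<forall>k\<in>S. \<forall>l\<in>S. \<forall>m\<in>S. k \<noteq> l \<and> l \<noteq> m \<and> k \<noteq> m \<longrightarrow> \<not> concurrent3 k l m)"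

(* M stands for the curve of all x with homog x \<bullet> (M *v homog x) = 0, completed by its
   points at infinity.  Forms without real zeros are not excluded here, but they have no
   tangent lines in the sense below. *)
definition nondegenerate_conic :: "real^3^3 \<Rightarrow> bool" where
  "nondegenerate_conic M \<longleftrightarrow> transpose M = M \<and> det M \<noteq> 0"

(* l is the tangent (the polar) of the conic at one of its points p.  The point p may be at
   infinity, so the asymptotes of a hyperbola are tangents. *)
definition tangent_to :: "(real^2) set \<Rightarrow> real^3^3 \<Rightarrow> bool" where
  "tangent_to l M \<longleftrightarrow>
     (\<exists>p. p \<noteq> 0 \<and> p \<bullet> (M *v p) = 0 \<and> proj_closure l = {q. q \<bullet> (M *v p) = 0})"

(* A degenerate conic, regarded as an envelope of lines, is a pair of (possibly equal)
   projective points P, Q; its tangents are the lines through P or Q. *)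
definition tangent_to_point_pair :: "(real^2) set \<Rightarrow> real^3 \<Rightarrow> real^3 \<Rightarrow> bool" where
  "tangent_to_point_pair l P Q \<longleftrightarrow> P \<in> proj_closure l \<or> Q \<in> proj_closure l"

end

(* A line through A is determined by the values (0, v, w) at A, B, C of an affine function vanishing
   on it; since reflection in the bisector exchanges the directions of AB and AC, the symmetric line
   has values (0, AB^2 w, AC^2 v).  Hence a dual conic
   BC^2 u^2 + CA^2 v^2 + AB^2 w^2 + 2f vw + 2g uw + 2h uv contains a line through A other than the
   sides if and only if it contains the symmetric one, so f, g, h can be chosen to fit all six lines.
   The determinant of this form is, up to a nonzero factor, the product of four Ceva expressions,
   each of which vanishes iff three of the lines, one of each pair, concur; when it is nonzero, the
   inverse form is the conic.  If three of the lines meet in a point P, the form vanishes on the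
   pencil of lines through P and therefore splits into two linear factors, that is, two points.
   If a line is a side, so is its symmetric line, and the form is written down directly. *)
theory Submission
  imports Defs
begin

section \<open>Lines as covectors\<close>

text \<open>\<open>n\<close> is the coefficient vector of an equation of \<open>l\<close>, so
  \<open>homog x \<bullet> n\<close> is an affine function of \<open>x\<close>. The affine and the
  projective equation are kept together so that the span in \<open>proj_closure\<close> is computed
  only once.\<close>

definition covector :: "(real^2) set \<Rightarrow> real^3 \<Rightarrow> bool" where
  "covector l n \<longleftrightarrow> n \<noteq> 0 \<and> l = {x. homog x \<bullet> n = 0} \<and> proj_closure l = {q. q \<bullet> n = 0}"

lemma inner_real2: "x \<bullet> y = x $ 1 * y $ 1 + x $ 2 * y $ 2" for x y :: "real^2"
  by (simp add: inner_vec_def sum_2)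

lemma inner_real3: "x \<bullet> y = x $ 1 * y $ 1 + x $ 2 * y $ 2 + x $ 3 * y $ 3" for x y :: "real^3"
  by (simp add: inner_vec_def sum_3)

lemma homog_nonzero [simp]: "homog x \<noteq> 0"
  by (simp add: homog_def vec_eq_iff forall_3)

text \<open>The constant term of the equation is \<open>- (m \<bullet> A)\<close>. The plane
  \<open>q \<bullet> n = 0\<close> is spanned by \<open>homog A\<close> and by the point at infinity
  in the direction \<open>d\<close> orthogonal to \<open>m\<close>.\<close>

lemma covector_of_normal:
  fixes m A :: "real^2"
  assumes "m \<noteq> 0"
  shows "\<exists>n. covector {x. m \<bullet> (x - A) = 0} n \<and> (\<forall>x. homog x \<bullet> n = m \<bullet> (x - A))"
proof -
  define n :: "real^3" where "n = vector [m $ 1, m $ 2, - (m \<bullet> A)]"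
  let ?l = "{x. m \<bullet> (x - A) = 0}"
  have ev: "homog x \<bullet> n = m \<bullet> (x - A)" for x
    by (simp add: homog_def n_def inner_real3 inner_real2 algebra_simps)
  have n0: "n \<noteq> 0"
    using assms by (simp add: n_def vec_eq_iff forall_2 forall_3) blast
  define d :: "real^2" where "d = vector [- (m $ 2), m $ 1]"
  have "A \<in> ?l" "A + d \<in> ?l"
    by (simp_all add: d_def inner_real2)
  then have hA: "homog A \<in> span (homog ` ?l)" and hd: "homog (A + d) \<in> span (homog ` ?l)"
    by (auto intro: span_base)
  have mm: "m \<bullet> m \<noteq> 0"
    using assms by simp
  have "proj_closure ?l = {q. q \<bullet> n = 0}"
  proof
    have "homog ` ?l \<subseteq> {q. q \<bullet> n = 0}"
      using ev by auto
    moreover have "subspace {q. q \<bullet> n = 0}"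
      using subspace_hyperplane[of n] by (simp add: inner_commute)
    ultimately show "proj_closure ?l \<subseteq> {q. q \<bullet> n = 0}"
      unfolding proj_closure_def by (rule span_minimal)
    show "{q. q \<bullet> n = 0} \<subseteq> proj_closure ?l"
    proof
      fix q assume "q \<in> {q. q \<bullet> n = 0}"
      then have q: "m $ 1 * (q $ 1 - q $ 3 * A $ 1) + m $ 2 * (q $ 2 - q $ 3 * A $ 2) = 0"
        by (simp add: inner_real3 inner_real2 n_def algebra_simps)
      \<comment> \<open>The vector \<open>q - q $ 3 *\<^sub>R homog A\<close> has third coordinate 0
        and its planar part is orthogonal to \<open>m\<close>, hence a multiple of \<open>d\<close>;
        \<open>t\<close> is the projection coefficient, since \<open>d\<close> and \<open>m\<close>
        have equal length.\<close>
      define t where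
        "t = (m $ 1 * (q $ 2 - q $ 3 * A $ 2) - m $ 2 * (q $ 1 - q $ 3 * A $ 1)) / (m \<bullet> m)"
      have t: "t * (m $ 1 * m $ 1 + m $ 2 * m $ 2) =
          m $ 1 * (q $ 2 - q $ 3 * A $ 2) - m $ 2 * (q $ 1 - q $ 3 * A $ 1)"
        using mm by (simp add: t_def inner_real2)
      have mm': "m $ 1 * m $ 1 + m $ 2 * m $ 2 \<noteq> 0"
        using mm by (simp add: inner_real2)
      have "(q $ 1 - q $ 3 * A $ 1 + t * m $ 2) * (m $ 1 * m $ 1 + m $ 2 * m $ 2) = 0"
        using q t by algebra
      then have "q $ 1 - q $ 3 * A $ 1 + t * m $ 2 = 0"
        using mm' by auto
      then have q1: "q $ 1 = q $ 3 * A $ 1 - t * m $ 2"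
        by linarith
      have "(q $ 2 - q $ 3 * A $ 2 - t * m $ 1) * (m $ 1 * m $ 1 + m $ 2 * m $ 2) = 0"
        using q t by algebra
      then have "q $ 2 - q $ 3 * A $ 2 - t * m $ 1 = 0"
        using mm' by auto
      then have q2: "q $ 2 = q $ 3 * A $ 2 + t * m $ 1"
        by linarith
      have "q = q $ 3 *\<^sub>R homog A + t *\<^sub>R (homog (A + d) - homog A)"
        using q1 q2 by (simp add: vec_eq_iff forall_3 homog_def d_def)
      moreover have "\<dots> \<in> span (homog ` ?l)"
        by (intro span_add span_scale span_diff hA hd)
      ultimately show "q \<in> proj_closure ?l"
        by (simp add: proj_closure_def)
    qed
  qed
  then have "covector ?l n"
    using ev n0 by (simp add: covector_def)
  then show ?thesis
    using ev by blast
qed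

lemma line_through_normal:
  assumes "is_line l" "A \<in> l"
  obtains m where "m \<noteq> 0" "l = {x. m \<bullet> (x - A) = 0}"
proof -
  have "affine l" "aff_dim l = int (DIM(real^2) - 1)"
    using assms(1) by (auto simp: is_line_def)
  then obtain m r where m: "m \<noteq> 0" "l = {x. m \<bullet> x = r}"
    by (metis aff_dim_eq_hyperplane affine_hull_eq)
  with assms(2) have "l = {x. m \<bullet> (x - A) = 0}"
    by (auto simp: inner_diff_right)
  with m(1) show ?thesis
    by (rule that)
qed

section \<open>Bisectors and reflections\<close>

text \<open>By injectivity of arccos on [-1, 1] the cosines agree, and after cancelling
  \<open>norm z\<close> this is a linear condition on \<open>z\<close>.\<close>

lemma vec_angle_eq_iff:
  assumes "x \<noteq> 0" "y \<noteq> 0"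
  shows "vec_angle x z = vec_angle y z \<longleftrightarrow> (sgn x - sgn y) \<bullet> z = 0"
proof (cases "z = 0")
  case True
  \<comment> \<open>Division by zero yields 0, so both angles are \<open>arccos 0\<close>.\<close>
  then show ?thesis by (simp add: vec_angle_def)
next
  case False
  have bd: "\<bar>v \<bullet> w / (norm v * norm w)\<bar> \<le> 1" for v w :: "real^2"
    using Cauchy_Schwarz_ineq2[of v w]
    by (cases "v = 0 \<or> w = 0") (auto simp: divide_le_eq abs_mult)
  have "vec_angle x z = vec_angle y z \<longleftrightarrow> x \<bullet> z / (norm x * norm z) = y \<bullet> z / (norm y * norm z)"
    unfolding vec_angle_def by (rule arccos_eq_iff) (use bd in blast)
  also have "\<dots> \<longleftrightarrow> (sgn x - sgn y) \<bullet> z = 0"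
    using False assms by (simp add: sgn_div_norm inner_diff_left field_simps)
  finally show ?thesis .
qed

lemma angle_bisector_eq_hyperplane:
  assumes "B \<noteq> A" "C \<noteq> A"
  shows "angle_bisector B A C = {x. (sgn (B - A) - sgn (C - A)) \<bullet> (x - A) = 0}"
  using assms by (auto simp: angle_bisector_def vec_angle_eq_iff)

text \<open>The orthogonal projection is the closest point because Cauchy-Schwarz bounds
  \<open>norm e * norm (x - z)\<close> below by the fixed number
  \<open>\<bar>e \<bullet> (x - A)\<bar>\<close> for every \<open>z\<close> of the
  hyperplane.\<close>

lemma reflection_in_hyperplane:
  assumes "e \<noteq> 0"
  shows "reflection_in {x. e \<bullet> (x - A) = 0} x = x - (2 * (e \<bullet> (x - A)) / (e \<bullet> e)) *\<^sub>R e"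
proof -
  let ?S = "{x. e \<bullet> (x - A) = 0}"
  let ?p = "x - ((e \<bullet> (x - A)) / (e \<bullet> e)) *\<^sub>R e"
  have S: "?S = {x. e \<bullet> x = e \<bullet> A}"
    by (auto simp: inner_diff_right)
  have "?p = closest_point ?S x"
  proof (rule closest_point_unique)
    show "convex ?S" "closed ?S"
      unfolding S by (rule convex_hyperplane closed_hyperplane)+
    show p: "?p \<in> ?S"
      using assms by (simp add: inner_diff_right)
    show "\<forall>z\<in>?S. dist x ?p \<le> dist x z"
    proof
      fix z assume z: "z \<in> ?S"
      have "e \<bullet> (x - A) = e \<bullet> (x - z)"
        using z by (simp add: inner_diff_right)
      then have "\<bar>e \<bullet> (x - A)\<bar> \<le> norm e * norm (x - z)"
        by (metis Cauchy_Schwarz_ineq2)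
      then have "\<bar>e \<bullet> (x - A)\<bar> / norm e \<le> norm (x - z)"
        using assms by (simp add: divide_le_eq mult.commute)
      moreover have "dist x ?p = \<bar>e \<bullet> (x - A)\<bar> / norm e"
        using assms by (simp add: dist_norm dot_square_norm power2_eq_square)
      ultimately show "dist x ?p \<le> dist x z"
        by (simp add: dist_norm)
    qed
  qed
  then show ?thesis
    unfolding reflection_in_def
    by (simp flip: \<open>?p = closest_point ?S x\<close>) (simp add: scaleR_right_diff_distrib scaleR_2)
qed

text \<open>For unit vectors the squared length of \<open>u - w\<close> is twice
  \<open>(u - w) \<bullet> u\<close>, so the coefficient is 1 at \<open>u\<close> and, by symmetry,
  -1 at \<open>w\<close>.\<close>

lemma reflection_swaps_unit_vectors:
  fixes u w :: "'a::real_inner"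
  assumes "norm u = 1" "norm w = 1" "u \<noteq> w"
  shows "u - (2 * ((u - w) \<bullet> u) / ((u - w) \<bullet> (u - w))) *\<^sub>R (u - w) = w"
    and "w - (2 * ((u - w) \<bullet> w) / ((u - w) \<bullet> (u - w))) *\<^sub>R (u - w) = u"
proof -
  have uu: "u \<bullet> u = 1" "w \<bullet> w = 1"
    using assms by (simp_all add: dot_square_norm)
  have e: "(u - w) \<bullet> (u - w) \<noteq> 0"
    using assms by simp
  have 1: "2 * ((u - w) \<bullet> u) = (u - w) \<bullet> (u - w)" and 2: "2 * ((u - w) \<bullet> w) = - ((u - w) \<bullet> (u - w))"
    using uu by (simp_all add: inner_diff_left inner_diff_right inner_commute)
  show "u - (2 * ((u - w) \<bullet> u) / ((u - w) \<bullet> (u - w))) *\<^sub>R (u - w) = w"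
    unfolding 1 using e by simp
  show "w - (2 * ((u - w) \<bullet> w) / ((u - w) \<bullet> (u - w))) *\<^sub>R (u - w) = u"
    unfolding 2 using e by simp
qed

text \<open>Guarantees that the normal \<open>sgn (B - A) - sgn (C - A)\<close> of the bisector is
  nonzero: equal directions would make \<open>C - A\<close> a multiple of
  \<open>B - A\<close>.\<close>

lemma sgn_diff_neq_if_not_collinear:
  fixes A B C :: "'a::euclidean_space"
  assumes "\<not> collinear {A, B, C}"
  shows "B \<noteq> A" "C \<noteq> A" "sgn (B - A) \<noteq> sgn (C - A)"
proof -
  show BA: "B \<noteq> A" and CA: "C \<noteq> A"
    using assms by (auto simp: insert_commute)
  show "sgn (B - A) \<noteq> sgn (C - A)"
  proof
    assume eq: "sgn (B - A) = sgn (C - A)"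
    have "C - A = norm (C - A) *\<^sub>R sgn (C - A)"
      using CA by (simp add: sgn_div_norm)
    also have "\<dots> = (norm (C - A) / norm (B - A)) *\<^sub>R (B - A)"
      unfolding eq[symmetric] by (simp add: sgn_div_norm divide_inverse)
    finally have "collinear {0, B - A, C - A}"
      using collinear_lemma by blast
    then have "collinear {B, A, C}"
      using collinear_3[of B A C] by simp
    then show False
      using assms by (simp add: insert_commute)
  qed
qed

(* n and n' are covectors of two lines through A symmetric in the bisector at A; the factors come
   from scaling n' so as to avoid square roots. *)
definition isogonal_covectors ::
    "real^2 \<Rightarrow> real^2 \<Rightarrow> real^2 \<Rightarrow> real^3 \<Rightarrow> real^3 \<Rightarrow> bool" where
  "isogonal_covectors A B C n n' \<longleftrightarrow>
     homog A \<bullet> n = 0 \<and> homog A \<bullet> n' = 0 \<and>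
     homog B \<bullet> n' = (dist A B)\<^sup>2 * (homog C \<bullet> n) \<and> homog C \<bullet> n' = (dist A C)\<^sup>2 * (homog B \<bullet> n)"

text \<open>The linear part \<open>r\<close> of the reflection is a self-adjoint involution, so a
  line with normal \<open>m\<close> goes to the line with normal \<open>r m\<close>. As
  \<open>r\<close> exchanges the unit vectors along the two sides, the values at \<open>B\<close>
  and \<open>C\<close> trade places up to the ratio of side lengths.\<close>

lemma reflected_line_covectors:
  assumes nc: "\<not> collinear {A, B, C}" and l: "is_line l" "A \<in> l"
    and l': "l' = reflection_in (angle_bisector B A C) ` l"
  shows "\<exists>n n'. covector l n \<and> covector l' n' \<and> isogonal_covectors A B C n n'"
proof -
  note ne = sgn_diff_neq_if_not_collinear[OF nc]
  define u where "u = sgn (B - A)"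
  define w where "w = sgn (C - A)"
  define e where "e = u - w"
  have uw: "norm u = 1" "norm w = 1" "u \<noteq> w" "e \<noteq> 0"
    using ne by (simp_all add: u_def w_def e_def norm_sgn)
  define r where "r x = x - (2 * (e \<bullet> x) / (e \<bullet> e)) *\<^sub>R e" for x
  have rr: "r (r x) = x" for x
    using uw(4) by (simp add: r_def inner_diff_right)
  have swap: "a \<bullet> r b = r a \<bullet> b" for a b
    by (simp add: r_def inner_diff_right inner_diff_left inner_commute)
  have ref: "reflection_in (angle_bisector B A C) x = A + r (x - A)" for x
    using reflection_in_hyperplane[OF uw(4), of A x] ne
    by (simp add: angle_bisector_eq_hyperplane r_def e_def u_def w_def)
  obtain m where m: "m \<noteq> 0" "l = {x. m \<bullet> (x - A) = 0}"
    using line_through_normal[OF l] .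
  \<comment> \<open>Unscaled, \<open>r m\<close> takes at \<open>B\<close> the value of
    \<open>m\<close> at \<open>C\<close> times \<open>dist A B / dist A C\<close>; this factor turns
    the ratio into \<open>(dist A B)\<^sup>2\<close>, and likewise at \<open>C\<close>.\<close>
  define m' where "m' = (dist A B * dist A C) *\<^sub>R r m"
  have k: "dist A B * dist A C \<noteq> 0"
    using ne by simp
  have "r m \<noteq> 0"
    using rr[of m] m(1) by (auto simp: r_def)
  then have m'0: "m' \<noteq> 0"
    using k by (simp add: m'_def)
  have "l' = {x. m' \<bullet> (x - A) = 0}"
  proof (intro set_eqI iffI)
    fix y assume "y \<in> l'"
    then obtain x where "y = A + r (x - A)" "m \<bullet> (x - A) = 0"
      unfolding l' m(2) by (auto simp: ref)
    then show "y \<in> {x. m' \<bullet> (x - A) = 0}"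
      by (simp add: m'_def rr flip: swap)
  next
    fix y assume "y \<in> {x. m' \<bullet> (x - A) = 0}"
    then have "A + r (y - A) \<in> l"
      using k by (simp add: m(2) m'_def swap)
    moreover have "y = reflection_in (angle_bisector B A C) (A + r (y - A))"
      by (simp add: ref rr)
    ultimately show "y \<in> l'"
      unfolding l' by blast
  qed
  then obtain n' where n': "covector l' n'" "\<And>x. homog x \<bullet> n' = m' \<bullet> (x - A)"
    using covector_of_normal[OF m'0] by metis
  obtain n where n: "covector l n" "\<And>x. homog x \<bullet> n = m \<bullet> (x - A)"
    using covector_of_normal[OF m(1)] m(2) by metis
  have B: "B - A = dist A B *\<^sub>R u" and C: "C - A = dist A C *\<^sub>R w"
    using ne by (simp_all add: u_def w_def sgn_div_norm dist_norm norm_minus_commute)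
  have ru: "r u = w" "r w = u"
    using reflection_swaps_unit_vectors[OF uw(1-3)] by (simp_all add: r_def e_def)
  have "m' \<bullet> (B - A) = (dist A B)\<^sup>2 * (m \<bullet> (C - A))" "m' \<bullet> (C - A) = (dist A C)\<^sup>2 * (m \<bullet> (B - A))"
    unfolding B C by (simp_all add: m'_def ru power2_eq_square flip: swap)
  then have "isogonal_covectors A B C n n'"
    by (simp add: isogonal_covectors_def n n')
  then show ?thesis
    using n(1) n'(1) by blast
qed

section \<open>Dual conics and the nondegenerate case\<close>

text \<open>A dual conic in the coordinates (u, v, w) of a line, the values of its equation at the
  vertices. In them the sides and the lines through a vertex have zero entries.\<close>

definition dual_form ::
    "real \<Rightarrow> real \<Rightarrow> real \<Rightarrow> real \<Rightarrow> real \<Rightarrow> real \<Rightarrow> real^2 \<Rightarrow> real^2 \<Rightarrow> real^2 \<Rightarrow> real^3 \<Rightarrow> real" where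
  "dual_form a b c f g h A B C n =
     a * (homog A \<bullet> n)\<^sup>2 + b * (homog B \<bullet> n)\<^sup>2 + c * (homog C \<bullet> n)\<^sup>2 +
     2 * f * (homog B \<bullet> n) * (homog C \<bullet> n) + 2 * g * (homog A \<bullet> n) * (homog C \<bullet> n) +
     2 * h * (homog A \<bullet> n) * (homog B \<bullet> n)"

text \<open>A nonzero linear part would put the three vertices on one line; a constant function with
  a zero vanishes.\<close>

lemma homog_inner_eq_0_imp_eq_0:
  assumes nc: "\<not> collinear {A, B, C}"
    and z: "homog A \<bullet> n = 0" "homog B \<bullet> n = 0" "homog C \<bullet> n = 0"
  shows "n = 0"
proof -
  define m :: "real^2" where "m = vector [n $ 1, n $ 2]"
  have ev: "homog x \<bullet> n = m \<bullet> x + n $ 3" for x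
    by (simp add: homog_def m_def inner_real3 inner_real2)
  have m0: "m = 0"
  proof (rule ccontr)
    assume "m \<noteq> 0"
    then have "aff_dim {x. m \<bullet> x = - n $ 3} = 1"
      by (simp add: aff_dim_hyperplane)
    moreover have "{A, B, C} \<subseteq> {x. m \<bullet> x = - n $ 3}"
      using z by (simp add: ev)
    ultimately have "aff_dim {A, B, C} \<le> 1"
      by (metis aff_dim_subset)
    then show False
      using nc by (simp add: collinear_aff_dim)
  qed
  then have "n $ 3 = 0"
    using z(1) by (simp add: ev)
  moreover have "n $ 1 = 0 \<and> n $ 2 = 0"
    using m0 by (simp add: m_def vec_eq_iff forall_2)
  ultimately show ?thesis
    by (simp add: vec_eq_iff forall_3)
qed

definition vertex_matrix :: "real^2 \<Rightarrow> real^2 \<Rightarrow> real^2 \<Rightarrow> real^3^3" where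
  "vertex_matrix A B C = vector [homog A, homog B, homog C]"

lemma vertex_matrix_mult:
  "vertex_matrix A B C *v n = vector [homog A \<bullet> n, homog B \<bullet> n, homog C \<bullet> n]"
  by (simp add: vertex_matrix_def vec_eq_iff forall_3 matrix_vector_mult_def inner_vec_def)

lemma vertex_matrix_invertible:
  assumes "\<not> collinear {A, B, C}"
  shows "invertible (vertex_matrix A B C)"
proof -
  have "n = 0" if "vertex_matrix A B C *v n = 0" for n
    using that by (intro homog_inner_eq_0_imp_eq_0[OF assms])
      (simp_all add: vertex_matrix_mult vec_eq_iff forall_3)
  then show ?thesis
    by (metis matrix_left_invertible_ker invertible_left_inverse)
qed

text \<open>The symmetric coefficient matrix of the form, carried from vertex values to Cartesian
  covectors by congruence.\<close>

definition dual_matrix ::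
    "real \<Rightarrow> real \<Rightarrow> real \<Rightarrow> real \<Rightarrow> real \<Rightarrow> real \<Rightarrow> real^2 \<Rightarrow> real^2 \<Rightarrow> real^2 \<Rightarrow> real^3^3" where
  "dual_matrix a b c f g h A B C =
     transpose (vertex_matrix A B C) **
     (vector [vector [a, h, g], vector [h, b, f], vector [g, f, c]] ** vertex_matrix A B C)"

lemma transpose_dual_matrix:
  "transpose (dual_matrix a b c f g h A B C) = dual_matrix a b c f g h A B C"
proof -
  have "transpose (vector [vector [a, h, g], vector [h, b, f], vector [g, f, c]] :: real^3^3) =
      vector [vector [a, h, g], vector [h, b, f], vector [g, f, c]]"
    by (simp add: transpose_def vec_eq_iff forall_3)
  then show ?thesis
    by (simp add: dual_matrix_def matrix_transpose_mul matrix_mul_assoc)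
qed

lemma dual_matrix_form: "n \<bullet> (dual_matrix a b c f g h A B C *v n) = dual_form a b c f g h A B C n"
proof -
  let ?D = "vector [vector [a, h, g], vector [h, b, f], vector [g, f, c]] :: real^3^3"
  have D: "?D *v vector [u, v, w] = vector [a * u + h * v + g * w, h * u + b * v + f * w,
      g * u + f * v + c * w]" for u v w
    by (simp add: vec_eq_iff forall_3 matrix_vector_mult_def sum_3)
  have "n \<bullet> (dual_matrix a b c f g h A B C *v n) =
      (vertex_matrix A B C *v n) \<bullet> (?D *v (vertex_matrix A B C *v n))"
    by (simp only: dual_matrix_def dot_lmul_matrix[symmetric] vector_transpose_matrix
        matrix_vector_mul_assoc[symmetric])
  also have "\<dots> = dual_form a b c f g h A B C n"
    by (simp add: vertex_matrix_mult D inner_real3 dual_form_def power2_eq_square algebra_simps)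
  finally show ?thesis .
qed

lemma det_dual_matrix:
  "det (dual_matrix a b c f g h A B C) =
     (det (vertex_matrix A B C))\<^sup>2 * (a * b * c + 2 * f * g * h - a * f\<^sup>2 - b * g\<^sup>2 - c * h\<^sup>2)"
  by (simp add: dual_matrix_def det_mul det_3[of "vector _"] power2_eq_square algebra_simps)

text \<open>The point conic is the inverse \<open>M\<close> of the dual matrix. A line with covector
  \<open>n\<close> on the dual conic touches it at its pole, the image of \<open>n\<close> under the
  dual matrix.\<close>

lemma nondegenerate_conic_of_dual_form:
  assumes nc: "\<not> collinear {A, B, C}"
    and d: "a * b * c + 2 * f * g * h - a * f\<^sup>2 - b * g\<^sup>2 - c * h\<^sup>2 \<noteq> 0"
    and S: "\<forall>l\<in>S. \<exists>n. covector l n \<and> dual_form a b c f g h A B C n = 0"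
  shows "\<exists>M. nondegenerate_conic M \<and> (\<forall>l\<in>S. tangent_to l M)"
proof -
  let ?D = "dual_matrix a b c f g h A B C"
  have "det ?D \<noteq> 0"
    using d vertex_matrix_invertible[OF nc] by (simp add: det_dual_matrix invertible_det_nz)
  then obtain M where M: "?D ** M = mat 1" "M ** ?D = mat 1"
    by (metis invertible_det_nz invertible_def)
  \<comment> \<open>A left inverse and a right inverse of the same matrix coincide, which makes
    \<open>M\<close> symmetric.\<close>
  have "transpose M ** ?D = mat 1"
    using M(1) by (metis matrix_transpose_mul transpose_dual_matrix transpose_mat)
  then have "transpose M = M"
    by (metis M(1) matrix_mul_assoc matrix_mul_lid matrix_mul_rid)
  moreover have "det M \<noteq> 0"
    using M by (metis invertible_det_nz invertible_def)
  moreover have "tangent_to l M" if l: "l \<in> S" for l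
  proof -
    obtain n where n: "n \<noteq> 0" "proj_closure l = {q. q \<bullet> n = 0}" "dual_form a b c f g h A B C n = 0"
      using S l by (auto simp: covector_def)
    have Mn: "M *v (?D *v n) = n"
      by (simp add: matrix_vector_mul_assoc M)
    moreover have "?D *v n \<noteq> 0"
      using Mn n(1) by auto
    moreover have "(?D *v n) \<bullet> n = 0"
      using n(3) dual_matrix_form by (metis inner_commute)
    ultimately show ?thesis
      unfolding tangent_to_def using n(2) by metis
  qed
  ultimately show ?thesis
    unfolding nondegenerate_conic_def by blast
qed

section \<open>The degenerate case: a pair of points\<close>

lemma covector_neq:
  assumes "covector k n" "covector l n'" "homog x \<bullet> n = 0" "homog x \<bullet> n' \<noteq> 0"
  shows "k \<noteq> l"
  using assms by (auto simp: covector_def)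

lemma covector_not_scaleR:
  assumes "covector k n" "covector l n'" "k \<noteq> l" shows "n' \<noteq> t *\<^sub>R n"
  using assms by (auto simp: covector_def)

text \<open>Distinct lines have independent covectors, and \<open>p\<close> is nonzero and
  orthogonal to both, so the three vectors form a basis of 3-space.\<close>

lemma covectors_basis:
  assumes k: "covector k n1" and l: "covector l n2" and ne: "k \<noteq> l"
    and p: "p \<noteq> 0" "p \<bullet> n1 = 0" "p \<bullet> n2 = 0"
  shows "\<exists>a s t. x = a *\<^sub>R p + s *\<^sub>R n1 + t *\<^sub>R n2"
proof -
  have n: "n1 \<noteq> 0" "n2 \<noteq> 0" and np: "\<And>t. n2 \<noteq> t *\<^sub>R n1"
    using covector_not_scaleR[OF k l ne] k l by (auto simp: covector_def)
  have pp: "p \<bullet> p \<noteq> 0"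
    using p by simp
  have 1: "n1 \<notin> span {}" using n by simp
  have 2: "n2 \<notin> span {n1}"
    using np by (auto simp: span_singleton)
  have 3: "p \<notin> span {n2, n1}"
  proof
    assume "p \<in> span {n2, n1}"
    then obtain s t where "p = s *\<^sub>R n2 + t *\<^sub>R n1"
      by (auto simp: span_breakdown_eq algebra_simps)
    then have "p \<bullet> p = 0"
      using p by (metis inner_add_right inner_scaleR_right mult_zero_right add_0)
    then show False using pp by simp
  qed
  have ind: "independent {p, n2, n1}"
    using 1 2 3 by (simp add: independent_insert)
  have "n1 \<noteq> n2" "p \<noteq> n1" "p \<noteq> n2"
    using 2 3 by (auto intro: span_base)
  then have "card {p, n2, n1} = 3" by simp
  then have "UNIV \<subseteq> span {p, n2, n1}"
    by (intro card_ge_dim_independent[OF _ ind]) simp_all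
  then have "x \<in> span {p, n2, n1}" by blast
  then obtain a t s where "x - a *\<^sub>R p - t *\<^sub>R n2 - s *\<^sub>R n1 = 0"
    by (auto simp: span_breakdown_eq)
  then have "x = a *\<^sub>R p + s *\<^sub>R n1 + t *\<^sub>R n2"
    by (simp add: algebra_simps)
  then show ?thesis by blast
qed

text \<open>On the two-dimensional space of covectors orthogonal to \<open>p\<close> the form has
  three pairwise nonproportional zeros, hence vanishes there. It is then divisible by
  \<open>p \<bullet> x\<close>, and the cofactor gives the second point; \<open>n0\<close> keeps
  that point nonzero.\<close>

lemma point_pair_of_dual_form:
  assumes S: "\<forall>l\<in>S. \<exists>n. covector l n \<and> dual_form a b c f g h A B C n = 0"
    and nz: "dual_form a b c f g h A B C n0 \<noteq> 0"
    and conc: "\<not> no_three_concurrent S"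
  shows "\<exists>P Q. P \<noteq> 0 \<and> Q \<noteq> 0 \<and> (\<forall>l\<in>S. tangent_to_point_pair l P Q)"
proof -
  define D where "D = dual_matrix a b c f g h A B C"
  define \<Phi> where "\<Phi> x = x \<bullet> (D *v x)" for x
  have \<Phi>: "\<Phi> x = dual_form a b c f g h A B C x" for x
    by (simp add: \<Phi>_def D_def dual_matrix_form)
  have sym: "x \<bullet> (D *v y) = y \<bullet> (D *v x)" for x y
    by (metis D_def dot_lmul_matrix inner_commute transpose_dual_matrix transpose_matrix_vector)
  have add: "\<Phi> (x + y) = \<Phi> x + 2 * (x \<bullet> (D *v y)) + \<Phi> y" for x y
    using sym[of y x] by (simp add: \<Phi>_def matrix_vector_right_distrib inner_add_left inner_add_right)
  have sc: "\<Phi> (s *\<^sub>R x) = s\<^sup>2 * \<Phi> x" for s x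
    by (simp add: \<Phi>_def matrix_vector_mult_scaleR power2_eq_square)
  obtain k l m p where klm: "k \<in> S" "l \<in> S" "m \<in> S" "k \<noteq> l" "l \<noteq> m" "k \<noteq> m"
    and p: "p \<noteq> 0" "p \<in> proj_closure k" "p \<in> proj_closure l" "p \<in> proj_closure m"
    using conc by (auto simp: no_three_concurrent_def concurrent3_def)
  obtain n1 n2 n3 where n: "covector k n1" "covector l n2" "covector m n3"
    and z: "\<Phi> n1 = 0" "\<Phi> n2 = 0" "\<Phi> n3 = 0"
    using S klm(1-3) by (metis \<Phi>)
  have pn: "p \<bullet> n1 = 0" "p \<bullet> n2 = 0" "p \<bullet> n3 = 0"
    using n p by (auto simp: covector_def)
  have pp: "p \<bullet> p \<noteq> 0"
    using p by simp
  obtain a' s t where n3: "n3 = a' *\<^sub>R p + s *\<^sub>R n1 + t *\<^sub>R n2"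
    using covectors_basis[OF n(1,2) klm(4) p(1) pn(1,2)] by blast
  have "p \<bullet> n3 = a' * (p \<bullet> p)"
    by (simp add: n3 inner_add_right pn)
  then have "a' = 0"
    using pn pp by simp
  then have n3': "n3 = s *\<^sub>R n1 + t *\<^sub>R n2"
    using n3 by simp
  \<comment> \<open>If a coefficient were 0, \<open>n3\<close> would be proportional to the covector
    of another of the three lines.\<close>
  have s: "s \<noteq> 0"
    using covector_not_scaleR[OF n(2,3) klm(5)] n3' by force
  have t: "t \<noteq> 0"
    using covector_not_scaleR[OF n(1,3) klm(6)] n3' by force
  \<comment> \<open>The square terms vanish, so only the mixed term of the expansion is
    left.\<close>
  have "2 * (s * (t * (n1 \<bullet> (D *v n2)))) = \<Phi> n3"
    by (simp add: n3' add sc z(1,2) matrix_vector_mult_scaleR)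
  then have n12: "n1 \<bullet> (D *v n2) = 0"
    using s t z(3) by simp
  have plane: "\<Phi> (s *\<^sub>R n1 + t *\<^sub>R n2) = 0" for s t
    by (simp add: add sc z matrix_vector_mult_scaleR n12)
  \<comment> \<open>For \<open>x = a *\<^sub>R p + y\<close> with \<open>p \<bullet> y = 0\<close>
    and \<open>\<Phi> y = 0\<close>, the form equals
    \<open>a * (a * \<Phi> p + 2 * (p \<bullet> (D *v y)))\<close>. \<open>Q\<close> represents the
    second factor times \<open>p \<bullet> p\<close>; subtracting the multiple of \<open>p\<close>
    corrects the doubled \<open>\<Phi> p\<close> term.\<close>
  define Q where "Q = (2 * (p \<bullet> p)) *\<^sub>R (D *v p) - \<Phi> p *\<^sub>R p"
  have factor: "(p \<bullet> p)\<^sup>2 * \<Phi> x = (p \<bullet> x) * (Q \<bullet> x)" for x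
  proof -
    obtain a s t where x: "x = a *\<^sub>R p + s *\<^sub>R n1 + t *\<^sub>R n2"
      using covectors_basis[OF n(1,2) klm(4) p(1) pn(1,2)] by blast
    define y where "y = s *\<^sub>R n1 + t *\<^sub>R n2"
    have x': "x = a *\<^sub>R p + y" and y: "\<Phi> y = 0" "p \<bullet> y = 0"
      using plane by (simp_all add: x y_def pn inner_add_right)
    have "\<Phi> x = a\<^sup>2 * \<Phi> p + 2 * a * (p \<bullet> (D *v y))"
      by (simp add: x' add sc y)
    moreover have "p \<bullet> x = a * (p \<bullet> p)"
      by (simp add: x' inner_add_right y)
    moreover have "Q \<bullet> x = (p \<bullet> p) * (a * \<Phi> p + 2 * (p \<bullet> (D *v y)))"
      using sym[of p y] y(2)
      by (simp add: Q_def x' inner_add_right inner_diff_left inner_commute[of "D *v p"] \<Phi>_def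
          algebra_simps)
    ultimately show ?thesis
      by (simp add: power2_eq_square algebra_simps)
  qed
  have "Q \<noteq> 0"
    using factor[of n0] nz pp by (auto simp: \<Phi>)
  moreover have "tangent_to_point_pair l p Q" if "l \<in> S" for l
  proof -
    obtain n where "covector l n" "\<Phi> n = 0"
      using S \<open>l \<in> S\<close> \<Phi> by metis
    moreover from this have "p \<bullet> n = 0 \<or> Q \<bullet> n = 0"
      using factor[of n] by simp
    ultimately show ?thesis
      by (auto simp: tangent_to_point_pair_def covector_def)
  qed
  ultimately show ?thesis
    using p(1) by blast
qed

section \<open>Concurrence and Ceva expressions\<close>

definition conic_envelope :: "(real^2) set set \<Rightarrow> bool" where
  "conic_envelope S \<longleftrightarrow>
     (no_three_concurrent S \<longrightarrow> (\<exists>M. nondegenerate_conic M \<and> (\<forall>l\<in>S. tangent_to l M))) \<and>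
     (\<not> no_three_concurrent S \<longrightarrow>
        (\<exists>P Q. P \<noteq> 0 \<and> Q \<noteq> 0 \<and> (\<forall>l\<in>S. tangent_to_point_pair l P Q)))"

lemma mem_covector_iff: "covector l n \<Longrightarrow> x \<in> l \<longleftrightarrow> homog x \<bullet> n = 0"
  by (simp add: covector_def)

lemma homog_mem_proj_closure: "x \<in> l \<Longrightarrow> homog x \<in> proj_closure l"
  by (auto simp: proj_closure_def intro: span_base)

lemma no_three_concurrentD:
  assumes "no_three_concurrent S" "{k, l, m} \<subseteq> S" "k \<noteq> l" "l \<noteq> m" "k \<noteq> m"
    and "x \<in> k" "x \<in> l" "x \<in> m"
  shows False
proof -
  have "concurrent3 k l m"
    using assms(6-8) homog_mem_proj_closure homog_nonzero unfolding concurrent3_def by blast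
  then show False
    using assms(1-5) unfolding no_three_concurrent_def by blast
qed

lemma exists_covector_values:
  assumes "\<not> collinear {A, B, C}"
  shows "\<exists>n. homog A \<bullet> n = u \<and> homog B \<bullet> n = v \<and> homog C \<bullet> n = w"
proof -
  obtain M where "vertex_matrix A B C ** M = mat 1"
    using vertex_matrix_invertible[OF assms] by (auto simp: invertible_def)
  then have "vertex_matrix A B C *v (M *v vector [u, v, w]) = vector [u, v, w]"
    by (simp add: matrix_vector_mul_assoc)
  then have "homog A \<bullet> (M *v vector [u, v, w]) = u \<and> homog B \<bullet> (M *v vector [u, v, w]) = v \<and>
      homog C \<bullet> (M *v vector [u, v, w]) = w"
    by (simp add: vertex_matrix_mult vec_eq_iff forall_3)
  then show ?thesis by blast
qed

text \<open>The expression is the determinant of the three triples of vertex values, so its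
  vanishing would give a common projective point. The nonzero values make the three lines
  distinct.\<close>

lemma ceva:
  assumes nc: "\<not> collinear {A, B, C}"
    and S: "no_three_concurrent S" "{k, l, m} \<subseteq> S"
    and cov: "covector k n1" "covector l n2" "covector m n3"
    and z: "homog A \<bullet> n1 = 0" "homog B \<bullet> n2 = 0" "homog C \<bullet> n3 = 0"
    and nz: "homog B \<bullet> n1 \<noteq> 0" "homog C \<bullet> n1 \<noteq> 0" "homog A \<bullet> n2 \<noteq> 0" "homog C \<bullet> n2 \<noteq> 0"
      "homog A \<bullet> n3 \<noteq> 0" "homog B \<bullet> n3 \<noteq> 0"
  shows "(homog B \<bullet> n1) * (homog C \<bullet> n2) * (homog A \<bullet> n3) +
         (homog C \<bullet> n1) * (homog A \<bullet> n2) * (homog B \<bullet> n3) \<noteq> 0"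
proof
  assume eq: "(homog B \<bullet> n1) * (homog C \<bullet> n2) * (homog A \<bullet> n3) +
         (homog C \<bullet> n1) * (homog A \<bullet> n2) * (homog B \<bullet> n3) = 0"
  \<comment> \<open>The common point of \<open>k\<close> and \<open>l\<close>: its barycentric
    coefficients are the cross product of the value triples of \<open>n1\<close> and
    \<open>n2\<close>.\<close>
  define p where "p = ((homog B \<bullet> n1) * (homog C \<bullet> n2)) *\<^sub>R homog A +
    ((homog C \<bullet> n1) * (homog A \<bullet> n2)) *\<^sub>R homog B - ((homog B \<bullet> n1) * (homog A \<bullet> n2)) *\<^sub>R homog C"
  have p: "p \<bullet> n = (homog B \<bullet> n1) * (homog C \<bullet> n2) * (homog A \<bullet> n) +
    (homog C \<bullet> n1) * (homog A \<bullet> n2) * (homog B \<bullet> n) -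
    (homog B \<bullet> n1) * (homog A \<bullet> n2) * (homog C \<bullet> n)" for n
    by (simp add: p_def inner_add_left inner_diff_left)
  obtain n0 where "homog A \<bullet> n0 = 1" "homog B \<bullet> n0 = 0" "homog C \<bullet> n0 = 0"
    using exists_covector_values[OF nc] by blast
  then have "p \<bullet> n0 \<noteq> 0"
    using nz by (simp add: p)
  then have "p \<noteq> 0"
    by auto
  moreover have "p \<bullet> n1 = 0" "p \<bullet> n2 = 0" "p \<bullet> n3 = 0"
    using eq by (simp_all add: p z)
  ultimately have "concurrent3 k l m"
    using cov by (auto simp: concurrent3_def covector_def)
  moreover have "k \<noteq> l" "l \<noteq> m" "k \<noteq> m"
    using covector_neq[OF cov(1,2) z(1) nz(3)] covector_neq[OF cov(2,3) z(2) nz(6)]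
      covector_neq[OF cov(1,3) z(1) nz(5)] by blast+
  ultimately show False
    using S unfolding no_three_concurrent_def by blast
qed

lemma isogonal_covectors_swap:
  "isogonal_covectors A B C n n' \<Longrightarrow> isogonal_covectors A C B n n'"
  by (simp add: isogonal_covectors_def)

lemma covector_value_nonzero:
  assumes "\<not> collinear {A, B, C}" "covector l n"
  shows "homog A \<bullet> n \<noteq> 0 \<or> homog B \<bullet> n \<noteq> 0 \<or> homog C \<bullet> n \<noteq> 0"
  using homog_inner_eq_0_imp_eq_0[OF assms(1), of n] assms(2) by (auto simp: covector_def)

section \<open>Three pairs of isogonal lines\<close>

text \<open>Treats the three vertices alike, so that a case settled at \<open>A\<close> passes to
  the other vertices by \<open>rotate\<close> and \<open>swap\<close>.\<close>

locale isogonal_lines =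
  fixes A B C :: "real^2" and lA lA' lB lB' lC lC' :: "(real^2) set"
    and nA nA' nB nB' nC nC' :: "real^3"
  assumes nc: "\<not> collinear {A, B, C}"
    and cov: "covector lA nA" "covector lA' nA'" "covector lB nB" "covector lB' nB'"
      "covector lC nC" "covector lC' nC'"
    and iso: "isogonal_covectors A B C nA nA'" "isogonal_covectors B C A nB nB'"
      "isogonal_covectors C A B nC nC'"
begin

lemma rotate: "isogonal_lines B C A lB lB' lC lC' lA lA' nB nB' nC nC' nA nA'"
  using nc cov iso by unfold_locales (simp_all add: insert_commute)

lemma swap: "isogonal_lines A C B lA lA' lC lC' lB lB' nA nA' nC nC' nB nB'"
  using nc cov iso by unfold_locales (simp_all add: insert_commute isogonal_covectors_swap)

lemma dist_pos: "0 < dist A B" "0 < dist B C" "0 < dist C A"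
  using nc by (auto simp: insert_commute)

lemma vertex_values:
  shows "homog A \<bullet> nA = 0" "homog A \<bullet> nA' = 0"
    "homog B \<bullet> nA' = (dist A B)\<^sup>2 * (homog C \<bullet> nA)" "homog C \<bullet> nA' = (dist C A)\<^sup>2 * (homog B \<bullet> nA)"
    "homog B \<bullet> nB = 0" "homog B \<bullet> nB' = 0"
    "homog A \<bullet> nB' = (dist A B)\<^sup>2 * (homog C \<bullet> nB)" "homog C \<bullet> nB' = (dist B C)\<^sup>2 * (homog A \<bullet> nB)"
    "homog C \<bullet> nC = 0" "homog C \<bullet> nC' = 0"
    "homog A \<bullet> nC' = (dist C A)\<^sup>2 * (homog B \<bullet> nC)" "homog B \<bullet> nC' = (dist B C)\<^sup>2 * (homog A \<bullet> nC)"
  using iso by (simp_all add: isogonal_covectors_def dist_commute)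

lemma values_nonzero:
  "homog B \<bullet> nA \<noteq> 0 \<or> homog C \<bullet> nA \<noteq> 0" "homog A \<bullet> nB \<noteq> 0 \<or> homog C \<bullet> nB \<noteq> 0"
  "homog A \<bullet> nC \<noteq> 0 \<or> homog B \<bullet> nC \<noteq> 0"
  using covector_value_nonzero[OF nc] cov vertex_values by metis+

abbreviation lines where "lines \<equiv> {lA, lA', lB, lB', lC, lC'}"

lemma conic_envelope_not_side:
  assumes nz: "homog B \<bullet> nA \<noteq> 0" "homog C \<bullet> nA \<noteq> 0" "homog A \<bullet> nB \<noteq> 0" "homog C \<bullet> nB \<noteq> 0"
      "homog A \<bullet> nC \<noteq> 0" "homog B \<bullet> nC \<noteq> 0"
  shows "conic_envelope lines"
proof -
  define a where "a = (dist B C)\<^sup>2"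
  define b where "b = (dist C A)\<^sup>2"
  define c where "c = (dist A B)\<^sup>2"
  have abc: "a \<noteq> 0" "b \<noteq> 0" "c \<noteq> 0"
    using dist_pos by (simp_all add: a_def b_def c_def)
  define v1 w1 u2 w2 u3 v3 where
    "v1 = homog B \<bullet> nA" and "w1 = homog C \<bullet> nA" and "u2 = homog A \<bullet> nB" and "w2 = homog C \<bullet> nB"
    and "u3 = homog A \<bullet> nC" and "v3 = homog B \<bullet> nC"
  note vals = vertex_values[folded a_def b_def c_def, folded v1_def w1_def u2_def w2_def u3_def v3_def]
    v1_def[symmetric] w1_def[symmetric] u2_def[symmetric] w2_def[symmetric] u3_def[symmetric]
    v3_def[symmetric]
  have nz': "v1 \<noteq> 0" "w1 \<noteq> 0" "u2 \<noteq> 0" "w2 \<noteq> 0" "u3 \<noteq> 0" "v3 \<noteq> 0"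
    using nz by (simp_all add: vals)
  \<comment> \<open>Each mixed coefficient solves the equation that puts one line on the dual conic.
    With squared sides on the diagonal, the form at the symmetric line is a multiple of the form at
    the line itself.\<close>
  define f where "f = - (b * v1\<^sup>2 + c * w1\<^sup>2) / (2 * v1 * w1)"
  define g where "g = - (a * u2\<^sup>2 + c * w2\<^sup>2) / (2 * u2 * w2)"
  define h where "h = - (a * u3\<^sup>2 + b * v3\<^sup>2) / (2 * u3 * v3)"
  have f: "2 * f * v1 * w1 = - (b * v1\<^sup>2 + c * w1\<^sup>2)" and g: "2 * g * u2 * w2 = - (a * u2\<^sup>2 + c * w2\<^sup>2)"
    and h: "2 * h * u3 * v3 = - (a * u3\<^sup>2 + b * v3\<^sup>2)"
    using nz' by (simp_all add: f_def g_def h_def)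
  let ?F = "dual_form a b c f g h A B C"
  have F: "?F nA = 0" "?F nB = 0" "?F nC = 0"
    using f g h by (simp_all add: dual_form_def vals)
  have "?F nA' = b * c * (b * v1\<^sup>2 + c * w1\<^sup>2 + 2 * f * v1 * w1)"
    "?F nB' = a * c * (a * u2\<^sup>2 + c * w2\<^sup>2 + 2 * g * u2 * w2)"
    "?F nC' = a * b * (a * u3\<^sup>2 + b * v3\<^sup>2 + 2 * h * u3 * v3)"
    by (simp_all add: dual_form_def vals power2_eq_square algebra_simps)
  then have F': "?F nA' = 0" "?F nB' = 0" "?F nC' = 0"
    using f g h by simp_all
  have S: "\<forall>l\<in>lines. \<exists>n. covector l n \<and> ?F n = 0"
    using cov F F' by (simp only: ball_simps) blast
  show ?thesis
    unfolding conic_envelope_def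
  proof (intro conjI impI)
    assume nt: "no_three_concurrent lines"
    note ceva = ceva[OF nc nt]
    \<comment> \<open>The four triples are the original lines and those with exactly one line
      replaced by its symmetric line; their Ceva expressions are the factors of the
      determinant.\<close>
    have "v1 * w2 * u3 + w1 * u2 * v3 \<noteq> 0"
      using ceva[of lA lB lC nA nB nC] cov nz' by (simp add: vals)
    moreover have "c * w1 * w2 * u3 + b * v1 * u2 * v3 \<noteq> 0"
      using ceva[of lA' lB lC nA' nB nC] cov nz' abc by (simp add: vals)
    moreover have "v1 * (a * u2) * u3 + w1 * (c * w2) * v3 \<noteq> 0"
      using ceva[of lA lB' lC nA nB' nC] cov nz' abc by (simp add: vals)
    moreover have "v1 * w2 * (b * v3) + w1 * u2 * (a * u3) \<noteq> 0"
      using ceva[of lA lB lC' nA nB nC'] cov nz' abc by (simp add: vals)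
    moreover have "4 * (v1 * w1 * u2 * w2 * u3 * v3)\<^sup>2 *
        (a * b * c + 2 * f * g * h - a * f\<^sup>2 - b * g\<^sup>2 - c * h\<^sup>2) =
        - ((v1 * w2 * u3 + w1 * u2 * v3) * (c * w1 * w2 * u3 + b * v1 * u2 * v3) *
           (v1 * (a * u2) * u3 + w1 * (c * w2) * v3) * (v1 * w2 * (b * v3) + w1 * u2 * (a * u3)))"
      (is "?L = ?R")
    proof -
      \<comment> \<open>Clearing denominators leaves \<open>f\<close>, \<open>g\<close>,
        \<open>h\<close> only in the products for which the equations \<open>f\<close>,
        \<open>g\<close>, \<open>h\<close> give polynomials.\<close>
      define X Y Z where "X = v1 * w1" and "Y = u2 * w2" and "Z = u3 * v3"
      have "?L = 4 * X\<^sup>2 * Y\<^sup>2 * Z\<^sup>2 * a * b * c + (2 * f * v1 * w1) * (2 * g * u2 * w2) * (2 * h * u3 * v3) * X * Y * Z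
        - a * (2 * f * v1 * w1)\<^sup>2 * Y\<^sup>2 * Z\<^sup>2 - b * (2 * g * u2 * w2)\<^sup>2 * X\<^sup>2 * Z\<^sup>2 - c * (2 * h * u3 * v3)\<^sup>2 * X\<^sup>2 * Y\<^sup>2"
        unfolding X_def Y_def Z_def by algebra
      also have "\<dots> = ?R"
        unfolding f g h X_def Y_def Z_def by algebra
      finally show ?thesis .
    qed
    ultimately have "a * b * c + 2 * f * g * h - a * f\<^sup>2 - b * g\<^sup>2 - c * h\<^sup>2 \<noteq> 0"
      by auto
    then show "\<exists>M. nondegenerate_conic M \<and> (\<forall>l\<in>lines. tangent_to l M)"
      using nondegenerate_conic_of_dual_form[OF nc] S by blast
  next
    assume conc: "\<not> no_three_concurrent lines"
    obtain n0 where "homog A \<bullet> n0 = 1" "homog B \<bullet> n0 = 0" "homog C \<bullet> n0 = 0"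
      using exists_covector_values[OF nc] by blast
    then have "?F n0 \<noteq> 0"
      using abc by (simp add: dual_form_def)
    then show "\<exists>P Q. P \<noteq> 0 \<and> Q \<noteq> 0 \<and> (\<forall>l\<in>lines. tangent_to_point_pair l P Q)"
      using point_pair_of_dual_form[OF S _ conc] by blast
  qed
qed

(* If one line of the pair at B is a side, the other one is the other side. *)
lemma opposite_side_among_lines:
  assumes "homog A \<bullet> nB = 0 \<or> homog C \<bullet> nB = 0"
  obtains l where "l \<in> {lB, lB'}" "B \<in> l" "C \<in> l" "A \<notin> l"
proof (cases "homog C \<bullet> nB = 0")
  case True
  then have "B \<in> lB" "C \<in> lB" "A \<notin> lB"
    using vertex_values values_nonzero(2) mem_covector_iff[OF cov(3)] by simp_all
  then show ?thesis
    by (intro that[of lB]) simp_all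
next
  case False
  then have "B \<in> lB'" "C \<in> lB'" "A \<notin> lB'"
    using assms vertex_values dist_pos mem_covector_iff[OF cov(4)] by simp_all
  then show ?thesis
    by (intro that[of lB']) simp_all
qed

text \<open>Here the sides AC and BC are both among the lines. Were \<open>lC\<close> not a side, it
  would be a third line through \<open>C\<close>.\<close>

lemma sides_at_C_if_sides_at_B:
  assumes nt: "no_three_concurrent lines"
    and C: "C \<in> lA \<or> C \<in> lA'"
    and B: "homog A \<bullet> nB = 0 \<or> homog C \<bullet> nB = 0"
  shows "homog A \<bullet> nC = 0 \<or> homog B \<bullet> nC = 0"
proof (rule ccontr)
  assume neg: "\<not> ?thesis"
  have "A \<in> lA" "A \<in> lA'"
    using vertex_values mem_covector_iff[OF cov(1)] mem_covector_iff[OF cov(2)] by simp_all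
  then obtain k where k: "k \<in> {lA, lA'}" "C \<in> k" "A \<in> k"
    using C by blast
  obtain l where l: "l \<in> {lB, lB'}" "B \<in> l" "C \<in> l" "A \<notin> l"
    using opposite_side_among_lines[OF B] .
  have lC: "C \<in> lC" "A \<notin> lC" "B \<notin> lC"
    using neg vertex_values mem_covector_iff[OF cov(5)] by simp_all
  have "{k, l, lC} \<subseteq> lines"
    using k(1) l(1) by blast
  moreover have "k \<noteq> l" "l \<noteq> lC" "k \<noteq> lC"
    using k l lC by blast+
  ultimately show False
    using no_three_concurrentD[OF nt] k(2) l(3) lC(1) by metis
qed

text \<open>Now \<open>lA\<close> is the side AB and \<open>lA'\<close> the side AC. Without
  concurrence either all lines are sides, or the lines at \<open>B\<close> and at \<open>C\<close>
  are not sides and each of these two pairs collapses to one line.\<close>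

lemma conic_envelope_side:
  assumes A: "homog B \<bullet> nA = 0"
  shows "conic_envelope lines"
proof -
  define u2 w2 u3 v3 where "u2 = homog A \<bullet> nB" and "w2 = homog C \<bullet> nB"
    and "u3 = homog A \<bullet> nC" and "v3 = homog B \<bullet> nC"
  note vals = vertex_values A u2_def[symmetric] w2_def[symmetric] u3_def[symmetric] v3_def[symmetric]
  have mem: "B \<in> lA" "C \<in> lA'" "A \<in> lA" "A \<in> lA'" "B \<in> lB" "B \<in> lB'" "C \<in> lC" "C \<in> lC'"
    using cov[THEN mem_covector_iff] by (simp_all add: vals)
  show ?thesis
    unfolding conic_envelope_def
  proof (intro conjI impI)
    assume nt: "no_three_concurrent lines"
    interpret sw: isogonal_lines A C B lA lA' lC lC' lB lB' nA nA' nC nC' nB nB'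
      by (rule swap)
    have nt': "no_three_concurrent sw.lines"
      using nt by (simp add: insert_commute)
    show "\<exists>M. nondegenerate_conic M \<and> (\<forall>l\<in>lines. tangent_to l M)"
    proof (cases "u2 = 0 \<or> w2 = 0")
      case True
      then have "u3 = 0 \<or> v3 = 0"
        using sides_at_C_if_sides_at_B[OF nt] mem by (simp add: vals)
      \<comment> \<open>Without square terms the form vanishes on all sides; this one is dual to the
        Steiner inellipse.\<close>
      let ?F = "dual_form 0 0 0 1 1 1 A B C"
      have "?F nA = 0" "?F nA' = 0" "?F nB = 0" "?F nB' = 0" "?F nC = 0" "?F nC' = 0"
        using True \<open>u3 = 0 \<or> v3 = 0\<close> by (auto simp: dual_form_def vals)
      then have "\<forall>l\<in>lines. \<exists>n. covector l n \<and> ?F n = 0"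
        using cov by (simp only: ball_simps) blast
      then show ?thesis
        by (rule nondegenerate_conic_of_dual_form[OF nc, rotated]) simp
    next
      case B: False
      then have C: "u3 \<noteq> 0" "v3 \<noteq> 0"
        using sw.sides_at_C_if_sides_at_B[OF nt'] mem by (auto simp: vals)
      have Bm: "A \<notin> lB" "A \<notin> lB'" and Cm: "A \<notin> lC" "A \<notin> lC'"
        using B C dist_pos cov[THEN mem_covector_iff] by (simp_all add: vals)
      \<comment> \<open>Otherwise \<open>lA\<close>, \<open>lB\<close>, \<open>lB'\<close> would be
        three lines through \<open>B\<close>; the same argument at \<open>C\<close> uses
        \<open>lA'\<close>.\<close>
      have "lB = lB'"
        using no_three_concurrentD[OF nt, of lA lB lB' B] mem Bm by auto
      moreover have "lC = lC'"
        using no_three_concurrentD[OF nt, of lA' lC lC' C] mem Cm by auto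
      (* lB and lC leave f free; this choice makes the determinant nonzero. *)
      moreover define f g h where "f = - (u2 / w2) * (u3 / v3)" and "g = - (u2 / w2)"
        and "h = - (u3 / v3)"
      \<comment> \<open>The sides AB and AC force the two zeros; \<open>g\<close> and
        \<open>h\<close> then come from \<open>lB\<close> and \<open>lC\<close>, and the leading 2
        avoids halves.\<close>
      let ?F = "dual_form 2 0 0 f g h A B C"
      have "?F nA = 0" "?F nA' = 0" "?F nB = 0" "?F nC = 0"
        using B C by (simp_all add: dual_form_def vals f_def g_def h_def power2_eq_square)
      ultimately have "\<forall>l\<in>lines. \<exists>n. covector l n \<and> ?F n = 0"
        using cov by (simp only: ball_simps) blast
      moreover have "2 * 0 * 0 + 2 * f * g * h - 2 * f\<^sup>2 - 0 * g\<^sup>2 - 0 * h\<^sup>2 = - (2 * u2 * u3 / (w2 * v3))\<^sup>2"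
        by (simp add: f_def g_def h_def power2_eq_square mult_ac)
      then have "2 * 0 * 0 + 2 * f * g * h - 2 * f\<^sup>2 - 0 * g\<^sup>2 - 0 * h\<^sup>2 \<noteq> 0"
        using B C by simp
      ultimately show ?thesis
        using nondegenerate_conic_of_dual_form[OF nc] by blast
    qed
  next
    \<comment> \<open>The vertices \<open>B\<close> and \<open>C\<close> themselves serve as the
      point pair.\<close>
    have "\<forall>l\<in>lines. B \<in> l \<or> C \<in> l"
      using mem by simp
    then have "\<forall>l\<in>lines. homog B \<in> proj_closure l \<or> homog C \<in> proj_closure l"
      using homog_mem_proj_closure by blast
    then show "\<exists>P Q. P \<noteq> 0 \<and> Q \<noteq> 0 \<and> (\<forall>l\<in>lines. tangent_to_point_pair l P Q)"
      unfolding tangent_to_point_pair_def using homog_nonzero by blast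
  qed
qed

lemma conic_envelope_side':
  assumes "homog B \<bullet> nA = 0 \<or> homog C \<bullet> nA = 0"
  shows "conic_envelope lines"
proof -
  interpret sw: isogonal_lines A C B lA lA' lC lC' lB lB' nA nA' nC nC' nB nB'
    by (rule swap)
  have "sw.lines = lines" by auto
  then show ?thesis
    using assms conic_envelope_side sw.conic_envelope_side by metis
qed

text \<open>If some line is a side, a cyclic relabelling moves its vertex to
  \<open>A\<close>.\<close>

theorem conic_envelope_lines: "conic_envelope lines"
proof -
  interpret r1: isogonal_lines B C A lB lB' lC lC' lA lA' nB nB' nC nC' nA nA'
    by (rule rotate)
  interpret r2: isogonal_lines C A B lC lC' lA lA' lB lB' nC nC' nA nA' nB nB'
    by (rule r1.rotate)
  have "r1.lines = lines" "r2.lines = lines" by auto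
  then show ?thesis
    using conic_envelope_not_side conic_envelope_side' r1.conic_envelope_side'
      r2.conic_envelope_side' by metis
qed

end

section \<open>The theorem for the given lines\<close>

theorem mainTheorem2:
  fixes A B C :: "real^2"
    and lA lB lC lA' lB' lC' :: "(real^2) set"
  assumes "\<not> collinear {A, B, C}"
    and "is_line lA" and "A \<in> lA"
    and "is_line lB" and "B \<in> lB"
    and "is_line lC" and "C \<in> lC"
    and "lA' = reflection_in (angle_bisector B A C) ` lA"
    and "lB' = reflection_in (angle_bisector C B A) ` lB"
    and "lC' = reflection_in (angle_bisector A C B) ` lC"
  shows "(no_three_concurrent {lA, lA', lB, lB', lC, lC'} \<longrightarrow>
           (\<exists>M. nondegenerate_conic M \<and>
                (\<forall>l \<in> {lA, lA', lB, lB', lC, lC'}. tangent_to l M)))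
       \<and> (\<not> no_three_concurrent {lA, lA', lB, lB', lC, lC'} \<longrightarrow>
           (\<exists>P Q. P \<noteq> 0 \<and> Q \<noteq> 0 \<and>
                (\<forall>l \<in> {lA, lA', lB, lB', lC, lC'}. tangent_to_point_pair l P Q)))"
proof -
  have nc: "\<not> collinear {B, C, A}" "\<not> collinear {C, A, B}"
    using assms(1) by (simp_all add: insert_commute)
  obtain nA nA' where A: "covector lA nA" "covector lA' nA'" "isogonal_covectors A B C nA nA'"
    using reflected_line_covectors[OF assms(1-3,8)] by blast
  obtain nB nB' where B: "covector lB nB" "covector lB' nB'" "isogonal_covectors B C A nB nB'"
    using reflected_line_covectors[OF nc(1) assms(4,5,9)] by blast
  obtain nC nC' where C: "covector lC nC" "covector lC' nC'" "isogonal_covectors C A B nC nC'"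
    using reflected_line_covectors[OF nc(2) assms(6,7,10)] by blast
  interpret isogonal_lines A B C lA lA' lB lB' lC lC' nA nA' nB nB' nC nC'
    by unfold_locales (fact assms A B C)+
  show ?thesis
    using conic_envelope_lines unfolding conic_envelope_def .
qed

end
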